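(* Let $m\ge 2$, let $\sigma_0\in\{-1,+1\}$, and let $P$ be a real $(m-1)\times(m-1)$ signed permutation matrix. Define the $m\times m$ matrix $$A=\begin{bmatrix} 0_{1\times(m-1)} & \sigma_0\\ P & 0_{(m-1)\times 1}\end{bmatrix}.$$ If all eigenvalues of $A$ are real, then $A = S + E$ where $S$ is a real symmetric matrix and $E$ is a diagonal matrix each of whose diagonal entries belongs to $\{-1,0,+1\}$.
   Context: A real signed permutation matrix is a square matrix with all entries in $\{-1,0,+1\}$ having exactly one nonzero entry in each row and in each column. *)

theory Defs
  imports "Jordan_Normal_Form.Char_Poly" "HOL.Complex"
begin

text \<open>A real signed permutation matrix of size n: square, entries in {-1,0,1},
  exactly one nonzero entry in each row and in each column.\<close>
definition signed_perm_mat :: "nat \<Rightarrow> real mat \<Rightarrow> bool" where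
  "signed_perm_mat n P \<longleftrightarrow> P \<in> carrier_mat n n
     \<and> (\<forall>i<n. \<forall>j<n. P $$ (i,j) \<in> {-1, 0, 1})
     \<and> (\<forall>i<n. \<exists>!j. j < n \<and> P $$ (i,j) \<noteq> 0)
     \<and> (\<forall>j<n. \<exists>!i. i < n \<and> P $$ (i,j) \<noteq> 0)"

end

theory Submission
  imports Defs "HOL-Combinatorics.Cycles"
begin

text \<open>A signed permutation matrix A sends each unit vector e_j to \<plusminus>e_\<pi>(j) for a
  permutation \<pi>. If A is not symmetric, some cycle of \<pi> through b has length k \<ge> 3, or length 2
  with sign product -1. Then A^k e_b = c e_b with c = \<plusminus>1, and for every k-th root l of c the vector
  \<Sum>(s<k) l^(k-1-s) A^s e_b is an eigenvector for l; under the two conditions c has a non-real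
  k-th root. So a real spectrum forces A to be symmetric, and the block matrix of the theorem,
  itself a signed permutation matrix, splits with S = A and E = 0.\<close>

lemma funpow_mult_mat_vec_carrier:
  assumes "B \<in> carrier_mat n n" "e \<in> carrier_vec n"
  shows "(((*\<^sub>v) B) ^^ t) e \<in> carrier_vec n"
  using assms by (induction t) auto

text \<open>krylov_comb B l e t is \<Sum>(s<t) l^(t-1-s) B^s e, written in Horner form.\<close>

fun krylov_comb :: "'a::field mat \<Rightarrow> 'a \<Rightarrow> 'a vec \<Rightarrow> nat \<Rightarrow> 'a vec" where
  "krylov_comb B l e 0 = 0\<^sub>v (dim_vec e)"
| "krylov_comb B l e (Suc t) = l \<cdot>\<^sub>v krylov_comb B l e t + (((*\<^sub>v) B) ^^ t) e"

lemma krylov_comb_carrier: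
  assumes "B \<in> carrier_mat n n" "e \<in> carrier_vec n"
  shows "krylov_comb B l e t \<in> carrier_vec n"
  using assms funpow_mult_mat_vec_carrier[OF assms] by (induction t) auto

lemma mult_krylov_comb:
  assumes B: "B \<in> carrier_mat n n" and e: "e \<in> carrier_vec n"
  shows "B *\<^sub>v krylov_comb B l e t = l \<cdot>\<^sub>v krylov_comb B l e t + (((*\<^sub>v) B) ^^ t) e - l ^ t \<cdot>\<^sub>v e"
proof (induction t)
  case 0
  show ?case using B e by (intro eq_vecI) auto
next
  case (Suc t)
  let ?w = "krylov_comb B l e t" and ?u = "(((*\<^sub>v) B) ^^ t) e"
  have w: "?w \<in> carrier_vec n" and u: "?u \<in> carrier_vec n"
    using krylov_comb_carrier[OF B e] funpow_mult_mat_vec_carrier[OF B e] by blast+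
  have "B *\<^sub>v krylov_comb B l e (Suc t) = l \<cdot>\<^sub>v (B *\<^sub>v ?w) + B *\<^sub>v ?u"
    using B w u by (simp add: mult_add_distrib_mat_vec mult_mat_vec[OF B w])
  also have "\<dots> = l \<cdot>\<^sub>v (l \<cdot>\<^sub>v ?w + ?u - l ^ t \<cdot>\<^sub>v e) + B *\<^sub>v ?u"
    unfolding Suc ..
  also have "\<dots> = l \<cdot>\<^sub>v (l \<cdot>\<^sub>v ?w + ?u) + B *\<^sub>v ?u - l ^ Suc t \<cdot>\<^sub>v e"
    using B w u e by (intro eq_vecI) (simp_all add: algebra_simps)
  finally show ?case by simp
qed

lemma krylov_comb_index:
  assumes B: "B \<in> carrier_mat n n" and e: "e \<in> carrier_vec n" and i: "i < n"
    and gap: "\<And>s. 0 < s \<Longrightarrow> s < k \<Longrightarrow> ((((*\<^sub>v) B) ^^ s) e) $ i = 0"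
    and t: "0 < t" "t \<le> k"
  shows "krylov_comb B l e t $ i = l ^ (t - 1) * e $ i"
  using t
proof (induction t rule: nat_induct_non_zero)
  case 1
  show ?case using e i by simp
next
  case (Suc t)
  have "krylov_comb B l e (Suc t) $ i = l * krylov_comb B l e t $ i + ((((*\<^sub>v) B) ^^ t) e) $ i"
    using krylov_comb_carrier[OF B e, of l t] funpow_mult_mat_vec_carrier[OF B e, of t] i by auto
  also have "\<dots> = l * (l ^ (t - 1) * e $ i)"
    using Suc gap[of t] by simp
  also have "\<dots> = l ^ (Suc t - 1) * e $ i"
    using \<open>0 < t\<close> by (simp add: power_eq_if)
  finally show ?case .
qed

lemma eigenvalueI_periodic_vector:
  fixes B :: "'a::field mat"
  assumes B: "B \<in> carrier_mat n n" and e: "e \<in> carrier_vec n"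
    and period: "(((*\<^sub>v) B) ^^ k) e = l ^ k \<cdot>\<^sub>v e" and "0 < k" "l \<noteq> 0"
    and i: "i < n" "e $ i \<noteq> 0"
    and gap: "\<And>s. 0 < s \<Longrightarrow> s < k \<Longrightarrow> ((((*\<^sub>v) B) ^^ s) e) $ i = 0"
  shows "eigenvalue B l"
proof -
  let ?v = "krylov_comb B l e k"
  have v: "?v \<in> carrier_vec n"
    using krylov_comb_carrier[OF B e] .
  have "B *\<^sub>v ?v = l \<cdot>\<^sub>v ?v"
    using mult_krylov_comb[OF B e, of l k] v e unfolding period by auto
  moreover have "?v $ i \<noteq> 0"
    using krylov_comb_index[OF B e i(1) gap] assms by simp
  ultimately show ?thesis
    using v B i unfolding eigenvalue_def eigenvector_def by auto
qed

lemma exists_nonreal_root_of_sign: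
  assumes k: "2 \<le> k" and c: "c = 1 \<or> c = -1" and k2: "k = 2 \<Longrightarrow> c = -1"
  shows "\<exists>l::complex. l ^ k = c \<and> l \<notin> \<real>"
proof (cases "c = -1")
  case True
  have "cis (pi / k) ^ k = -1" using k by (simp add: DeMoivre)
  moreover have "sin (pi / k) > 0" using k by (intro sin_gt_zero) (auto simp: field_simps)
  ultimately show ?thesis using True by (intro exI[of _ "cis (pi / k)"]) (auto simp: complex_is_Real_iff)
next
  case False
  then have "c = 1" using c by simp
  then have "3 \<le> k" using k k2 by fastforce
  have "cis (2 * pi / k) ^ k = 1" using k by (simp add: DeMoivre)
  moreover have "sin (2 * pi / k) > 0" using \<open>3 \<le> k\<close> by (intro sin_gt_zero) (auto simp: field_simps)
  ultimately show ?thesis using \<open>c = 1\<close> by (intro exI[of _ "cis (2 * pi / k)"]) (auto simp: complex_is_Real_iff)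
qed

locale signed_perm =
  fixes n :: nat and A :: "real mat"
  assumes signed_perm_mat: "signed_perm_mat n A"
begin

lemma carrier: "A \<in> carrier_mat n n"
  using signed_perm_mat unfolding signed_perm_mat_def by blast

definition row_of :: "nat \<Rightarrow> nat" where
  "row_of j = (if j < n then THE i. i < n \<and> A $$ (i, j) \<noteq> 0 else j)"

definition sign_of :: "nat \<Rightarrow> real" where
  "sign_of j = A $$ (row_of j, j)"

lemma row_of_lt: "j < n \<Longrightarrow> row_of j < n"
  and sign_of_nonzero: "j < n \<Longrightarrow> sign_of j \<noteq> 0"
  using theI'[of "\<lambda>i. i < n \<and> A $$ (i, j) \<noteq> 0"] signed_perm_mat
  unfolding signed_perm_mat_def row_of_def sign_of_def by auto

lemma row_of_unique: "i < n \<Longrightarrow> j < n \<Longrightarrow> A $$ (i, j) \<noteq> 0 \<Longrightarrow> i = row_of j"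
  using the1_equality[of "\<lambda>i. i < n \<and> A $$ (i, j) \<noteq> 0"] signed_perm_mat
  unfolding signed_perm_mat_def row_of_def by auto

lemma entry_eq: "i < n \<Longrightarrow> j < n \<Longrightarrow> A $$ (i, j) = (if i = row_of j then sign_of j else 0)"
  using row_of_unique unfolding sign_of_def by auto

lemma sign_of_cases: "j < n \<Longrightarrow> sign_of j = 1 \<or> sign_of j = -1"
  using signed_perm_mat row_of_lt[of j] sign_of_nonzero[of j]
  unfolding signed_perm_mat_def sign_of_def by auto

lemma inj_on_row_of: "inj_on row_of {..<n}"
proof (rule inj_onI)
  fix x y assume "x \<in> {..<n}" "y \<in> {..<n}" "row_of x = row_of y"
  then show "x = y"
    using signed_perm_mat row_of_lt[of x] sign_of_nonzero[of x] sign_of_nonzero[of y]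
    unfolding signed_perm_mat_def sign_of_def by (metis lessThan_iff)
qed

lemma row_of_permutes: "row_of permutes {..<n}"
proof (rule bij_imp_permutes)
  have "row_of ` {..<n} \<subseteq> {..<n}" using row_of_lt by auto
  then show "bij_betw row_of {..<n} {..<n}"
    using inj_on_row_of endo_inj_surj[of "{..<n}" row_of] by (simp add: bij_betw_def)
qed (simp add: row_of_def)

lemma permutation_row_of: "permutation row_of"
  using permutes_imp_permutation[OF _ row_of_permutes] by simp

lemma funpow_row_of_lt: "j < n \<Longrightarrow> (row_of ^^ t) j < n"
  by (induction t) (auto simp: row_of_lt)

lemma symmetricI:
  assumes "\<And>j. j < n \<Longrightarrow> A $$ (j, row_of j) = sign_of j"
  shows "A\<^sup>T = A"
proof (rule eq_matI)
  fix i j assume "i < dim_row A" "j < dim_col A"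
  then have ij: "i < n" "j < n" using carrier by auto
  have "A $$ (j, i) = A $$ (i, j)"
  proof (cases "i = row_of j \<or> j = row_of i")
    case True
    then show ?thesis using assms[of i] assms[of j] ij unfolding sign_of_def by auto
  next
    case False
    then show ?thesis using entry_eq[of i j] entry_eq[of j i] ij by auto
  qed
  then show "A\<^sup>T $$ (i, j) = A $$ (i, j)" using ij carrier by auto
qed (use carrier in auto)

definition cycle_sign :: "nat \<Rightarrow> nat \<Rightarrow> real" where
  "cycle_sign t j = (\<Prod>r<t. sign_of ((row_of ^^ r) j))"

lemma cycle_sign_cases: "j < n \<Longrightarrow> cycle_sign t j = 1 \<or> cycle_sign t j = -1"
proof (induction t)
  case (Suc t)
  then show ?case
    using sign_of_cases[OF funpow_row_of_lt[OF Suc.prems, of t]]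
    by (auto simp: cycle_sign_def)
qed (simp add: cycle_sign_def)

abbreviation complexified :: "complex mat" where
  "complexified \<equiv> map_mat complex_of_real A"

lemma complexified_mult_unit_vec:
  assumes j: "j < n"
  shows "complexified *\<^sub>v unit_vec n j = complex_of_real (sign_of j) \<cdot>\<^sub>v unit_vec n (row_of j)"
proof (rule eq_vecI)
  fix i assume "i < dim_vec (complex_of_real (sign_of j) \<cdot>\<^sub>v unit_vec n (row_of j))"
  then have "i < n" by simp
  then show "(complexified *\<^sub>v unit_vec n j) $ i = (complex_of_real (sign_of j) \<cdot>\<^sub>v unit_vec n (row_of j)) $ i"
    using carrier j row_of_lt[OF j] entry_eq[of i j] by auto
qed (use carrier in auto)

lemma complexified_iterate_unit_vec:
  assumes j: "j < n"
  shows "(((*\<^sub>v) complexified) ^^ t) (unit_vec n j)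
    = complex_of_real (cycle_sign t j) \<cdot>\<^sub>v unit_vec n ((row_of ^^ t) j)"
proof (induction t)
  case (Suc t)
  have "(((*\<^sub>v) complexified) ^^ Suc t) (unit_vec n j)
      = complex_of_real (cycle_sign t j) \<cdot>\<^sub>v (complexified *\<^sub>v unit_vec n ((row_of ^^ t) j))"
    using Suc carrier by (simp add: mult_mat_vec[of _ n n])
  also have "\<dots> = complex_of_real (cycle_sign (Suc t) j) \<cdot>\<^sub>v unit_vec n ((row_of ^^ Suc t) j)"
    using complexified_mult_unit_vec[OF funpow_row_of_lt[OF j]]
    by (simp add: cycle_sign_def smult_smult_assoc)
  finally show ?case .
qed (simp add: cycle_sign_def)

lemma nonreal_eigenvalue_of_cycle:
  assumes b: "b < n" and long: "2 \<le> least_power row_of b"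
    and neg: "least_power row_of b = 2 \<Longrightarrow> cycle_sign 2 b = -1"
  shows "\<exists>l. eigenvalue complexified l \<and> l \<notin> \<real>"
proof -
  define k where "k = least_power row_of b"
  have period: "(row_of ^^ k) b = b"
    unfolding k_def by (rule least_power_of_permutation(1)[OF permutation_row_of])
  have gap: "(row_of ^^ s) b \<noteq> b" if "0 < s" "s < k" for s
    using least_power_le[where f = row_of and n = s and x = b] that unfolding k_def by auto
  obtain l where l: "l ^ k = complex_of_real (cycle_sign k b)" "l \<notin> \<real>"
    using exists_nonreal_root_of_sign[of k "complex_of_real (cycle_sign k b)"]
      cycle_sign_cases[OF b, of k] long neg unfolding k_def by auto
  have "eigenvalue complexified l"
  proof (rule eigenvalueI_periodic_vector)
    show "(((*\<^sub>v) complexified) ^^ k) (unit_vec n b) = l ^ k \<cdot>\<^sub>v unit_vec n b"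
      using complexified_iterate_unit_vec[OF b] period l(1) by simp
    show "(((*\<^sub>v) complexified) ^^ s) (unit_vec n b) $ b = 0" if "0 < s" "s < k" for s
      using complexified_iterate_unit_vec[OF b] funpow_row_of_lt[OF b, of s] gap[OF that] b by simp
    show "l \<noteq> 0" using l(2) by auto
  qed (use carrier b long k_def in auto)
  then show ?thesis using l(2) by blast
qed

lemma symmetric_if_real_eigenvalues:
  assumes real: "\<And>l. eigenvalue complexified l \<Longrightarrow> l \<in> \<real>"
  shows "A\<^sup>T = A"
proof (rule symmetricI, rule ccontr)
  fix b assume b: "b < n" and asym: "A $$ (b, row_of b) \<noteq> sign_of b"
  define a where "a = row_of b"
  have "a \<noteq> b" using asym unfolding a_def sign_of_def by auto
  then have "2 \<le> least_power row_of b"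
    using least_power_gt_one[OF permutation_row_of, of b] unfolding a_def by simp
  moreover have "cycle_sign 2 b = -1" if "least_power row_of b = 2"
  proof -
    have "row_of a = b"
      using least_power_of_permutation(1)[OF permutation_row_of, of b] that
      unfolding a_def by (simp add: numeral_2_eq_2)
    then have "A $$ (b, a) = sign_of a" unfolding sign_of_def by simp
    then have "sign_of a \<noteq> sign_of b" using asym unfolding a_def by simp
    moreover have "cycle_sign 2 b = sign_of b * sign_of a"
      unfolding cycle_sign_def a_def by (simp add: numeral_2_eq_2)
    ultimately show ?thesis
      using sign_of_cases[OF b] sign_of_cases[OF row_of_lt[OF b]] unfolding a_def by auto
  qed
  ultimately obtain l where "eigenvalue complexified l" "l \<notin> \<real>"
    using nonreal_eigenvalue_of_cycle[OF b] by blast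
  then show False using real by blast
qed

end

lemma signed_perm_mat_four_block:
  assumes P: "signed_perm_mat n P" and \<sigma>: "\<sigma> \<in> {-1, 1}"
  shows "signed_perm_mat (Suc n) (four_block_mat (0\<^sub>m 1 n) (mat 1 1 (\<lambda>_. \<sigma>)) P (0\<^sub>m n 1))"
proof -
  define M where "M = four_block_mat (0\<^sub>m 1 n) (mat 1 1 (\<lambda>_. \<sigma>)) P (0\<^sub>m n 1)"
  have Pc: "P \<in> carrier_mat n n" using P unfolding signed_perm_mat_def by blast
  have M: "M \<in> carrier_mat (Suc n) (Suc n)" using Pc unfolding M_def by auto
  have entry: "M $$ (i, j) = (if i = 0 then if j = n then \<sigma> else 0
      else if j < n then P $$ (i - 1, j) else 0)" if "i < Suc n" "j < Suc n" for i j
    using that Pc unfolding M_def by auto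
  show ?thesis
    unfolding M_def[symmetric] signed_perm_mat_def
  proof (intro conjI allI impI)
    fix i j assume "i < Suc n" "j < Suc n"
    then show "M $$ (i, j) \<in> {-1, 0, 1}"
      using entry P \<sigma> unfolding signed_perm_mat_def by auto
  next
    fix i assume i: "i < Suc n"
    show "\<exists>!j. j < Suc n \<and> M $$ (i, j) \<noteq> 0"
    proof (cases i)
      case 0
      show ?thesis
      proof (rule ex1I[of _ n])
        show "n < Suc n \<and> M $$ (i, n) \<noteq> 0" using entry[of i n] 0 \<sigma> by auto
        show "j = n" if "j < Suc n \<and> M $$ (i, j) \<noteq> 0" for j
          using that entry[of i j] 0 by (auto split: if_splits)
      qed
    next
      case (Suc i')
      then obtain j where j: "j < n" "P $$ (i', j) \<noteq> 0"
        and uniq: "\<And>j'. j' < n \<Longrightarrow> P $$ (i', j') \<noteq> 0 \<Longrightarrow> j' = j"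
        using P i unfolding signed_perm_mat_def by (metis Suc_less_SucD)
      show ?thesis
      proof (rule ex1I[of _ j])
        show "j < Suc n \<and> M $$ (i, j) \<noteq> 0" using entry[of i j] i j Suc by auto
        show "j' = j" if "j' < Suc n \<and> M $$ (i, j') \<noteq> 0" for j'
          using that entry[of i j'] i uniq[of j'] Suc by (auto split: if_splits)
      qed
    qed
  next
    fix j assume j: "j < Suc n"
    show "\<exists>!i. i < Suc n \<and> M $$ (i, j) \<noteq> 0"
    proof (cases "j = n")
      case True
      show ?thesis
      proof (rule ex1I[of _ 0])
        show "0 < Suc n \<and> M $$ (0, j) \<noteq> 0" using entry[of 0 j] True \<sigma> by auto
        show "i = 0" if "i < Suc n \<and> M $$ (i, j) \<noteq> 0" for i
          using that entry[of i j] True by (auto split: if_splits)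
      qed
    next
      case False
      then obtain i where i: "i < n" "P $$ (i, j) \<noteq> 0"
        and uniq: "\<And>i'. i' < n \<Longrightarrow> P $$ (i', j) \<noteq> 0 \<Longrightarrow> i' = i"
        using P j unfolding signed_perm_mat_def by (metis less_SucE)
      show ?thesis
      proof (rule ex1I[of _ "Suc i"])
        show "Suc i < Suc n \<and> M $$ (Suc i, j) \<noteq> 0" using entry[of "Suc i" j] i j False by auto
        show "i' = Suc i" if "i' < Suc n \<and> M $$ (i', j) \<noteq> 0" for i'
        proof -
          have "i' \<noteq> 0" "j < n" using that entry[of i' j] False j by (auto split: if_splits)
          then show ?thesis
            using that entry[of i' j] uniq[of "i' - 1"] by (cases i') auto
        qed
      qed
    qed
  qed (rule M)
qed

theorem lemma2:
  fixes m :: nat and \<sigma>0 :: real and P :: "real mat"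
  assumes "m \<ge> 2"
    and "\<sigma>0 \<in> {-1, 1}"
    and "signed_perm_mat (m - 1) P"
    and "\<forall>k. eigenvalue (map_mat complex_of_real
           (four_block_mat (0\<^sub>m 1 (m - 1)) (mat 1 1 (\<lambda>_. \<sigma>0)) P (0\<^sub>m (m - 1) 1))) k
           \<longrightarrow> k \<in> \<real>"
  shows "\<exists>S E. S \<in> carrier_mat m m \<and> S\<^sup>T = S
           \<and> E \<in> carrier_mat m m \<and> diagonal_mat E \<and> (\<forall>i<m. E $$ (i,i) \<in> {-1, 0, 1})
           \<and> four_block_mat (0\<^sub>m 1 (m - 1)) (mat 1 1 (\<lambda>_. \<sigma>0)) P (0\<^sub>m (m - 1) 1) = S + E"
proof -
  define M where "M = four_block_mat (0\<^sub>m 1 (m - 1)) (mat 1 1 (\<lambda>_. \<sigma>0)) P (0\<^sub>m (m - 1) 1)"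
  have "signed_perm_mat m M"
    using signed_perm_mat_four_block[OF assms(3,2)] assms(1) unfolding M_def
    by (simp add: Suc_diff_1)
  then interpret signed_perm m M by unfold_locales
  have "M\<^sup>T = M"
    by (rule symmetric_if_real_eigenvalues) (use assms(4) in \<open>simp add: M_def\<close>)
  then show ?thesis
    unfolding M_def[symmetric]
    by (intro exI[of _ M] exI[of _ "0\<^sub>m m m"]) (use carrier in \<open>auto simp: diagonal_mat_def\<close>)
qed

end
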